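(* If $f$ is such that $\rho(A|B)=f\bigl(p(A|B)\bigr)$ for every choice of the probability space $(\Omega,\Sigma,p)$, where $\rho$ is a transformation cost function for $p$, then $f$ is of the form $$f(\cdot)=-\tfrac{1}{\beta}\log(\cdot),$$ where $\beta$ is a real parameter.
   Context: Only finite measure spaces are considered. $(\Omega,\Sigma)$ is a measurable space with sample space $\Omega$ and $\sigma$-algebra $\Sigma$ on $\Omega$. $p:(\Sigma\times\Sigma)\to[0,1]$ is a conditional probability measure over $\Sigma$, where $p(A|B)$ denotes the conditional probability of $A$ given $B$; i.e. for any $A\in\Sigma$, $p(\cdot|A)$ is a probability measure over $A$. Being conditional probabilities, these satisfy the product rule $p(A\cap B|C)=p(A|C)\,p(B|A\cap C)$. A function $\rho:(\Sigma\times\Sigma)\to\mathbb{R}^+$ (with $\mathbb{R}^+$ the nonnegative reals) is a transformation cost function for $p$ iff it has the following three properties for all events $A,B,C,D\in\Sigma$: A1 (real-valued): there exists $f$ such that $\rho(A|B)=f\bigl(p(A|B)\bigr)\in\mathbb{R}$. A2 (additive): $\rho(A\cap B|C)=\rho(A|C)+\rho(B|A\cap C)$. A3 (monotonic): $[\rho(A|B)>\rho(C|D)]\Leftrightarrow[p(A|B)\lessgtr p(C|D)]$, where $\lessgtr$ leaves the direction of the monotonic order open: it stands for $<$ throughout or for $>$ throughout. In the theorem the same function $f$ serves for all probability spaces $(\Omega,\Sigma,p)$.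
   Formalization: Conditioning on the empty event is excluded, and nonnegativity and A1–A3 are required only for pairs with p(A|B) > 0, since a real f(0) would contradict A2 and A3; accordingly the formula for f is asserted on (0,1], with β nonzero. *)

theory Defs
  imports "HOL-Probability.Probability"
begin

text \<open>
  \<open>p A B\<close> stands for $p(A|B)$. No probability measure can be concentrated on the empty set,
  so \<open>{}\<close> is never used as a conditioning event and \<open>p A {}\<close> is unconstrained (up to its range).
  A null event may still be conditioned on, as long as it is nonempty.
\<close>

locale conditional_prob_space = sigma_algebra \<Omega> \<Sigma>
  for \<Omega> :: "'a set" and \<Sigma> :: "'a set set" and p :: "'a set \<Rightarrow> 'a set \<Rightarrow> real" +
  assumes finite_space: "finite \<Omega>"
    and space_nonempty: "\<Omega> \<noteq> {}"
    and range: "\<And>A B. A \<in> \<Sigma> \<Longrightarrow> B \<in> \<Sigma> \<Longrightarrow> p A B \<in> {0..1}"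
    and prob_measure: "\<And>B. B \<in> \<Sigma> \<Longrightarrow> B \<noteq> {} \<Longrightarrow>
      \<exists>N. prob_space N \<and> space N = \<Omega> \<and> sets N = \<Sigma> \<and> (\<forall>A\<in>\<Sigma>. measure N A = p A B)"
    and concentrated: "\<And>B. B \<in> \<Sigma> \<Longrightarrow> B \<noteq> {} \<Longrightarrow> p B B = 1"
    and product_rule: "\<And>A B C. A \<in> \<Sigma> \<Longrightarrow> B \<in> \<Sigma> \<Longrightarrow> C \<in> \<Sigma> \<Longrightarrow> C \<noteq> {} \<Longrightarrow>
      p (A \<inter> B) C = p A C * p B (A \<inter> C)"

text \<open>
  Costs are real numbers, so they can only be attached to pairs of events with
  $p(A|B) > 0$: a real cost $f(0)$ would satisfy $f(0) = f(a) + f(0)$ for all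
  $a$ in $(0,1)$ by additivity, hence $f(a) = 0$, against strict monotonicity.
\<close>

definition costed :: "'a set set \<Rightarrow> ('a set \<Rightarrow> 'a set \<Rightarrow> real) \<Rightarrow> 'a set \<Rightarrow> 'a set \<Rightarrow> bool" where
  "costed \<Sigma> p A B \<longleftrightarrow> A \<in> \<Sigma> \<and> B \<in> \<Sigma> \<and> B \<noteq> {} \<and> p A B > 0"

definition induced_by ::
  "'a set set \<Rightarrow> ('a set \<Rightarrow> 'a set \<Rightarrow> real) \<Rightarrow> ('a set \<Rightarrow> 'a set \<Rightarrow> real) \<Rightarrow> (real \<Rightarrow> real) \<Rightarrow> bool" where
  "induced_by \<Sigma> p \<rho> f \<longleftrightarrow> (\<forall>A B. costed \<Sigma> p A B \<longrightarrow> \<rho> A B = f (p A B))"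

text \<open>
  In \<open>additive\<close>, the hypothesis $p(A \cap B|C) > 0$ forces, by the product rule, $A \cap C$ to be
  nonempty and both $p(A|C)$ and $p(B|A \cap C)$ to be positive, so all three costs are meaningful.
\<close>

locale transformation_cost = conditional_prob_space \<Omega> \<Sigma> p
  for \<Omega> :: "'a set" and \<Sigma> p +
  fixes \<rho> :: "'a set \<Rightarrow> 'a set \<Rightarrow> real"
  assumes nonneg: "\<And>A B. costed \<Sigma> p A B \<Longrightarrow> \<rho> A B \<ge> 0"
    and real_valued: "\<exists>f. induced_by \<Sigma> p \<rho> f"
    and additive: "\<And>A B C. A \<in> \<Sigma> \<Longrightarrow> B \<in> \<Sigma> \<Longrightarrow> costed \<Sigma> p (A \<inter> B) C \<Longrightarrow>
      \<rho> (A \<inter> B) C = \<rho> A C + \<rho> B (A \<inter> C)"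
    and monotonic:
      "(\<forall>A B C D. costed \<Sigma> p A B \<longrightarrow> costed \<Sigma> p C D \<longrightarrow> (\<rho> A B > \<rho> C D \<longleftrightarrow> p A B < p C D)) \<or>
       (\<forall>A B C D. costed \<Sigma> p A B \<longrightarrow> costed \<Sigma> p C D \<longrightarrow> (\<rho> A B > \<rho> C D \<longleftrightarrow> p A B > p C D))"

end

theory Submission
  imports Defs
begin

text \<open>
  Three points of mass \<open>x * y\<close>, \<open>x * (1 - y)\<close> and \<open>1 - x\<close> carry two nested events whose successive
  conditional probabilities are any prescribed \<open>x\<close> and \<open>y\<close> in \<open>(0,1)\<close>
  (\<open>conditional_prob_space_weights\<close>).  Because a single \<open>f\<close> serves all spaces, additivity of the
  cost on these three-point spaces becomes the functional equation \<open>f (x * y) = f x + f y\<close>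
  (\<open>universal_cost_mult\<close>).  In the variable \<open>t = - ln x\<close> this is Cauchy's equation on the half-line
  \<open>t \<ge> 0\<close>.  Its solutions need not be linear in general, but costs are nonnegative, and a nonnegative
  additive function is monotone, hence linear (\<open>nonneg_additive_imp_linear\<close>).  So \<open>f x = - c * ln x\<close>
  with \<open>c \<ge> 0\<close>.  Finally \<open>c \<noteq> 0\<close>, because the monotonicity axiom, in either direction, separates
  the costs of probability \<open>1\<close> and probability \<open>1/2\<close>; so \<open>\<beta> = 1 / c\<close>.
\<close>

text \<open>
  Strict positivity of the weights makes \<open>w(B) > 0\<close> for every nonempty \<open>B\<close>, so that the ratio below
  is a probability measure for each conditioning event and the product rule is cancellation.
\<close>

lemma conditional_prob_space_weights:
  fixes w :: "'a \<Rightarrow> real"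
  assumes fin: "finite \<Omega>" and ne: "\<Omega> \<noteq> {}" and pos: "\<And>i. i \<in> \<Omega> \<Longrightarrow> w i > 0"
  shows "conditional_prob_space \<Omega> (Pow \<Omega>) (\<lambda>A B. sum w (A \<inter> B) / sum w B)"
proof -
  have wpos: "sum w B > 0" if "B \<subseteq> \<Omega>" "B \<noteq> {}" for B
    using that fin pos by (intro sum_pos) (auto intro: finite_subset)
  have wnn: "sum w (A \<inter> B) \<ge> 0" if "B \<subseteq> \<Omega>" for A B
    using that pos by (intro sum_nonneg) (auto intro: less_imp_le)
  have le: "sum w (A \<inter> B) \<le> sum w B" if "B \<subseteq> \<Omega>" for A B
    using that fin pos by (intro sum_mono2) (auto intro: finite_subset less_imp_le)
  show ?thesis
  proof (intro conditional_prob_space.intro conditional_prob_space_axioms.intro)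
    show "sigma_algebra \<Omega> (Pow \<Omega>)" by (rule sigma_algebra_Pow)
    show "finite \<Omega>" "\<Omega> \<noteq> {}" by fact+
    show "sum w (A \<inter> B) / sum w B \<in> {0..1}" if "A \<in> Pow \<Omega>" "B \<in> Pow \<Omega>" for A B
      using that wnn[of B B] wnn[of B A] le[of B A] by (auto simp: divide_le_eq_1)
    show "sum w (B \<inter> B) / sum w B = 1" if "B \<in> Pow \<Omega>" "B \<noteq> {}" for B
      using that wpos[of B] by simp
    show "sum w (A \<inter> B \<inter> C) / sum w C =
        sum w (A \<inter> C) / sum w C * (sum w (B \<inter> (A \<inter> C)) / sum w (A \<inter> C))"
      if "A \<in> Pow \<Omega>" "B \<in> Pow \<Omega>" "C \<in> Pow \<Omega>" "C \<noteq> {}" for A B C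
    proof (cases "A \<inter> C = {}")
      case True
      then have "A \<inter> B \<inter> C = {}" by blast
      with True show ?thesis by simp
    next
      case False
      then have "sum w (A \<inter> C) > 0" using that by (intro wpos) auto
      moreover have "A \<inter> B \<inter> C = B \<inter> (A \<inter> C)" by blast
      ultimately show ?thesis by simp
    qed
    show "\<exists>N. prob_space N \<and> space N = \<Omega> \<and> sets N = Pow \<Omega> \<and>
        (\<forall>A\<in>Pow \<Omega>. measure N A = sum w (A \<inter> B) / sum w B)"
      if B: "B \<in> Pow \<Omega>" "B \<noteq> {}" for B
    proof -
      define u where "u i = (if i \<in> B then w i / sum w B else 0)" for i
      have u0: "u i \<ge> 0" if "i \<in> \<Omega>" for i
        using that B wpos[of B] pos[of i] by (auto simp: u_def)
      define N where "N = point_measure \<Omega> (\<lambda>i. ennreal (u i))"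
      have sumu: "sum u A = sum w (A \<inter> B) / sum w B" if "A \<subseteq> \<Omega>" for A
        using that fin
        by (auto simp: u_def sum_divide_distrib sum.inter_restrict finite_subset intro!: sum.cong)
      have em: "emeasure N A = ennreal (sum w (A \<inter> B) / sum w B)" if "A \<subseteq> \<Omega>" for A
      proof -
        have "emeasure N A = (\<Sum>i\<in>A. ennreal (u i))"
          unfolding N_def using fin that by (simp add: emeasure_point_measure_finite)
        also have "\<dots> = ennreal (sum u A)"
          using that u0 by (intro sum_ennreal) auto
        finally show ?thesis using sumu[OF that] by simp
      qed
      have "prob_space N"
      proof
        have "\<Omega> \<inter> B = B" using B by blast
        then show "emeasure N (space N) = 1"
          using em[of \<Omega>] B wpos[of B] by (simp add: N_def space_point_measure)
      qed
      moreover have "measure N A = sum w (A \<inter> B) / sum w B" if "A \<in> Pow \<Omega>" for A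
        using that em[of A] B wnn[of B B] wnn[of B A]
        by (simp add: measure_def)
      ultimately show ?thesis
        by (intro exI[of _ N]) (auto simp: N_def space_point_measure sets_point_measure)
    qed
  qed
qed

text \<open>
  Additivity and nonnegativity give monotonicity.  Comparing \<open>n * t\<close> with the integers next to it then
  confines \<open>n * (g t - t * g 1)\<close> to an interval whose length does not depend on \<open>n\<close>, which
  is possible for all \<open>n\<close> only if \<open>g t = t * g 1\<close>.
\<close>

lemma nonneg_additive_imp_linear:
  fixes g :: "real \<Rightarrow> real"
  assumes add: "\<And>s t. s \<ge> 0 \<Longrightarrow> t \<ge> 0 \<Longrightarrow> g (s + t) = g s + g t"
    and nonneg: "\<And>t. t \<ge> 0 \<Longrightarrow> g t \<ge> 0"
    and t: "t \<ge> 0"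
  shows "g t = t * g 1"
proof -
  have mono: "g a \<le> g b" if "0 \<le> a" "a \<le> b" for a b
    using that add[of a "b - a"] nonneg[of "b - a"] by simp
  have mult: "g (real n * s) = real n * g s" if "s \<ge> 0" for n s
  proof (induction n)
    case 0
    show ?case using add[of 0 0] by simp
  next
    case (Suc n)
    have "real (Suc n) * s = real n * s + s" by (simp add: algebra_simps)
    with Suc show ?case using add[of "real n * s" s] that by (simp add: algebra_simps)
  qed
  have bound: "real n * \<bar>g t - t * g 1\<bar> \<le> g 1" for n
  proof -
    define k where "k = nat \<lfloor>real n * t\<rfloor>"
    have k: "real k \<le> real n * t" "real n * t \<le> real (Suc k)"
      using t by (auto simp: k_def) linarith
    have "real k * g 1 \<le> real n * g t" "real n * g t \<le> real (Suc k) * g 1"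
      using mono[OF _ k(1)] mono[OF _ k(2)] mult[of 1 k] mult[of 1 "Suc k"] mult[OF t, of n] t
      by auto
    moreover have "real k * g 1 \<le> real n * t * g 1" "real n * t * g 1 \<le> real (Suc k) * g 1"
      using k nonneg[of 1] by (auto intro: mult_right_mono simp del: of_nat_Suc)
    moreover have "real n * \<bar>g t - t * g 1\<bar> = \<bar>real n * g t - real n * t * g 1\<bar>"
    proof -
      have "real n * g t - real n * t * g 1 = real n * (g t - t * g 1)"
        by (simp add: algebra_simps)
      then show ?thesis by (simp add: abs_mult)
    qed
    ultimately show ?thesis by (simp add: algebra_simps abs_le_iff)
  qed
  show ?thesis
  proof (rule ccontr)
    assume "g t \<noteq> t * g 1"
    then have "\<bar>g t - t * g 1\<bar> > 0" by simp
    then obtain n where "g 1 < real n * \<bar>g t - t * g 1\<bar>"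
      using reals_Archimedean3 by blast
    with bound[of n] show False by simp
  qed
qed

text \<open>
  The nested events \<open>{0} \<subseteq> {0, 1} \<subseteq> {0, 1, 2}\<close> of a single space have successive conditional
  probabilities \<open>y\<close> and \<open>x\<close>, so each cost axiom, applied to them, yields one property of \<open>f\<close>.
\<close>

lemma universal_cost_three_points:
  fixes f :: "real \<Rightarrow> real"
  assumes universal: "\<And>(\<Omega> :: nat set) \<Sigma> p. conditional_prob_space \<Omega> \<Sigma> p \<Longrightarrow>
    \<exists>\<rho>. transformation_cost \<Omega> \<Sigma> p \<rho> \<and> induced_by \<Sigma> p \<rho> f"
    and x: "0 < x" "x < 1" and y: "0 < y" "y < 1"
  shows "f (x * y) = f x + f y" "f 1 = 0" "f x \<ge> 0" "f x \<noteq> f 1"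
proof -
  define w where "w = (\<lambda>i::nat. if i = 0 then x * y else if i = 1 then x * (1 - y) else 1 - x)"
  define \<Omega> :: "nat set" where "\<Omega> = {0, 1, 2}"
  define p where "p = (\<lambda>A B. sum w (A \<inter> B) / sum w B)"
  have "conditional_prob_space \<Omega> (Pow \<Omega>) p"
    unfolding p_def using x y by (intro conditional_prob_space_weights) (auto simp: \<Omega>_def w_def)
  then obtain \<rho> where \<rho>: "transformation_cost \<Omega> (Pow \<Omega>) p \<rho>" and ind: "induced_by (Pow \<Omega>) p \<rho> f"
    using universal by blast
  interpret transformation_cost \<Omega> "Pow \<Omega>" p \<rho> by (rule \<rho>)
  have sums: "sum w \<Omega> = 1" "sum w {0, 1} = x" "sum w {0} = x * y"
    by (simp_all add: \<Omega>_def w_def algebra_simps)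
  have sub: "\<Omega> \<inter> \<Omega> = \<Omega>" "{0, 1} \<inter> \<Omega> = {0, 1}" "{0} \<inter> \<Omega> = {0}" "{0} \<inter> {0, 1} = {0::nat}"
      "{0, 1} \<inter> {0} = {0::nat}"
    by (auto simp: \<Omega>_def)
  have p: "p \<Omega> \<Omega> = 1" "p {0, 1} \<Omega> = x" "p {0} \<Omega> = x * y" "p {0} {0, 1} = y"
    unfolding p_def sub sums using x by auto
  have c: "costed (Pow \<Omega>) p \<Omega> \<Omega>" "costed (Pow \<Omega>) p {0, 1} \<Omega>" "costed (Pow \<Omega>) p {0} \<Omega>"
      "costed (Pow \<Omega>) p {0} {0, 1}"
    using p x y unfolding costed_def by (auto simp: \<Omega>_def)
  have r: "\<rho> \<Omega> \<Omega> = f 1" "\<rho> {0, 1} \<Omega> = f x" "\<rho> {0} \<Omega> = f (x * y)" "\<rho> {0} {0, 1} = f y"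
    using ind c p unfolding induced_by_def by metis+
  have ev: "\<Omega> \<in> Pow \<Omega>" "{0, 1} \<in> Pow \<Omega>" "{0} \<in> Pow \<Omega>" by (auto simp: \<Omega>_def)
  show "f (x * y) = f x + f y"
    using additive[of "{0, 1}" "{0}" \<Omega>] ev c r unfolding sub by simp
  show "f 1 = 0"
    using additive[of \<Omega> \<Omega> \<Omega>] ev c r unfolding sub by simp
  show "f x \<ge> 0"
    using nonneg[OF c(2)] r by simp
  show "f x \<noteq> f 1"
    using monotonic
  proof
    assume "\<forall>A B C D. costed (Pow \<Omega>) p A B \<longrightarrow> costed (Pow \<Omega>) p C D \<longrightarrow>
      (\<rho> A B > \<rho> C D \<longleftrightarrow> p A B < p C D)"
    then have "\<rho> {0, 1} \<Omega> > \<rho> \<Omega> \<Omega> \<longleftrightarrow> p {0, 1} \<Omega> < p \<Omega> \<Omega>" using c(1,2) by blast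
    then show ?thesis using x p r by simp
  next
    assume "\<forall>A B C D. costed (Pow \<Omega>) p A B \<longrightarrow> costed (Pow \<Omega>) p C D \<longrightarrow>
      (\<rho> A B > \<rho> C D \<longleftrightarrow> p A B > p C D)"
    then have "\<rho> \<Omega> \<Omega> > \<rho> {0, 1} \<Omega> \<longleftrightarrow> p \<Omega> \<Omega> > p {0, 1} \<Omega>" using c(1,2) by blast
    then show ?thesis using x p r by simp
  qed
qed

text \<open>
  The boundary cases \<open>x = 1\<close> or \<open>y = 1\<close> would need points of mass zero; they follow from \<open>f 1 = 0\<close>
  instead.
\<close>

lemma universal_cost_mult:
  fixes f :: "real \<Rightarrow> real"
  assumes universal: "\<And>(\<Omega> :: nat set) \<Sigma> p. conditional_prob_space \<Omega> \<Sigma> p \<Longrightarrow>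
    \<exists>\<rho>. transformation_cost \<Omega> \<Sigma> p \<rho> \<and> induced_by \<Sigma> p \<rho> f"
    and x: "0 < x" "x \<le> 1" and y: "0 < y" "y \<le> 1"
  shows "f (x * y) = f x + f y"
proof -
  have "f 1 = 0" using universal_cost_three_points(2)[OF universal, of "1/2" "1/2"] by simp
  moreover have "f (x * y) = f x + f y" if "x < 1" "y < 1"
    using universal_cost_three_points(1)[OF universal] x y that by blast
  ultimately show ?thesis using x y by (cases "x = 1"; cases "y = 1") auto
qed

theorem theorem1:
  fixes f :: "real \<Rightarrow> real"
  assumes "\<And>(\<Omega> :: nat set) \<Sigma> p. conditional_prob_space \<Omega> \<Sigma> p \<Longrightarrow>
    \<exists>\<rho>. transformation_cost \<Omega> \<Sigma> p \<rho> \<and> induced_by \<Sigma> p \<rho> f"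
  shows "\<exists>\<beta>::real. \<beta> \<noteq> 0 \<and> (\<forall>x\<in>{0<..1}. f x = - (1 / \<beta>) * ln x)"
proof -
  note three_points = universal_cost_three_points[OF assms, where y = "1/2"]
  have nonneg: "f x \<ge> 0" if "0 < x" "x \<le> 1" for x
    using three_points(2,3)[of x] three_points(2)[of "1/2"] that by (cases "x = 1") auto
  define c where "c = f (exp (- 1))"
  have linear: "f (exp (- t)) = t * c" if "t \<ge> 0" for t
    unfolding c_def
  proof (rule nonneg_additive_imp_linear[where g = "\<lambda>t. f (exp (- t))"])
    show "f (exp (- (s + t))) = f (exp (- s)) + f (exp (- t))" if "s \<ge> 0" "t \<ge> 0" for s t
      using universal_cost_mult[OF assms, of "exp (- s)" "exp (- t)"] that
      by (simp flip: exp_add)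
  qed (use that nonneg in auto)
  have f_eq: "f x = - c * ln x" if "x \<in> {0<..1}" for x
    using linear[of "- ln x"] that by simp
  have "f (1/2) \<noteq> 0"
    using three_points(2,4)[of "1/2"] by simp
  then have "c \<noteq> 0" using f_eq[of "1/2"] by auto
  then show ?thesis using f_eq by (intro exI[of _ "1 / c"]) auto
qed

end
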